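(* Let $m \ge 2$ and $n \ge 1$ be integers. Suppose that $\mathcal{A} \in \mathbb{R}^{[m,n]}$ is a nonsingular M-tensor and $b \in \mathbb{R}^n$ is a positive vector. For $x \in \mathbb{R}^n$ and $t \in [0,1]$ let $H(x,t) = (1-t)(\mathcal{I}x^{m-1} - b) + t(\mathcal{A}x^{m-1} - b)$. Starting from the initial point $x(0) = x_0 = [b_1^{1/(m-1)}, b_2^{1/(m-1)}, \ldots, b_n^{1/(m-1)}]^T$, let $x(t)$ be the solution curve obtained by solving the homotopy $H(x,t) = 0$ in $\mathbb{R}_{++}^n \times [0,1]$. Then $x(1)$ is the unique positive solution of the system $\mathcal{A}x^{m-1} = b$.
   Context: $\mathbb{R}^{[m,n]}$ denotes the set of all $m$th-order, $n$-dimensional real tensors $\mathcal{A} = (A_{i_1 i_2 \ldots i_m})$, with each index $i_k \in \{1,\ldots,n\}$. For $\mathcal{A} \in \mathbb{R}^{[m,n]}$ and a vector $x$ in $\mathbb{R}^n$ or $\mathbb{C}^n$, $\mathcal{A}x^{m-1}$ denotes the vector whose $i$th entry is $(\mathcal{A} x^{m-1})_i = \sum_{i_2,\ldots,i_m=1}^n A_{i i_2 \ldots i_m} x_{i_2}\cdots x_{i_m}$, and $x^{[m-1]} = [x_1^{m-1},\ldots,x_n^{m-1}]^T$. A vector is positive if all its entries are positive; $\mathbb{R}_{++}^n$ is the set of positive vectors in $\mathbb{R}^n$; a positive solution is a solution lying in $\mathbb{R}_{++}^n$. A pair $(\lambda,x) \in \mathbb{C} \times (\mathbb{C}^n\setminus\{0\})$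 is an eigenpair of $\mathcal{A}$ (and $\lambda$ is an eigenvalue of $\mathcal{A}$) if $\mathcal{A}x^{m-1} = \lambda x^{[m-1]}$. The spectral radius is $\rho(\mathcal{A}) = \max\{|\lambda| : \lambda \text{ is an eigenvalue of } \mathcal{A}\}$. The identity tensor $\mathcal{I} \in \mathbb{R}^{[m,n]}$ has entry $1$ when all indices are equal and $0$ otherwise, so $\mathcal{I}x^{m-1} = x^{[m-1]}$. A tensor is nonnegative if all its entries are nonnegative. A tensor $\mathcal{A} \in \mathbb{R}^{[m,n]}$ is an M-tensor if it can be written as $\mathcal{A} = s\mathcal{I} - \mathcal{B}$ with $\mathcal{B} \in \mathbb{R}^{[m,n]}$ nonnegative and $s \in \mathbb{R}$, $s \ge \rho(\mathcal{B})$; it is a nonsingular M-tensor if it can be so written with $s > \rho(\mathcal{B})$. The solution curve of the homotopy starting from $x_0$ is the smooth map $t \mapsto x(t)$ from $[0,1]$ to $\mathbb{R}_{++}^n$ with $x(0) = x_0$ and $H(x(t),t) = 0$ for all $t \in [0,1]$. *)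

theory Defs
  imports "HOL-Analysis.Analysis"
begin

text \<open>
  A real tensor of order \<open>m\<close> and dimension \<open>n = CARD('n)\<close> is represented by its entry function
  on index lists; the notions below depend only on the entries at lists of length \<open>m\<close>.
\<close>

type_synonym 'n tensor = "'n list \<Rightarrow> real"

text \<open>The vector $\mathcal{A}x^{m-1}$, for real and for complex \<open>x\<close>; the list \<open>js\<close> is $(i_2,\ldots,i_m)$.\<close>

definition tensor_app ::
    "nat \<Rightarrow> 'n::finite tensor \<Rightarrow> 'a::real_normed_field ^ 'n \<Rightarrow> 'a ^ 'n" where
  "tensor_app m A x =
     (\<chi> i. \<Sum>js | length js = m - 1. of_real (A (i # js)) * (\<Prod>j\<leftarrow>js. x $ j))"

definition vec_power :: "'a::power ^ 'n \<Rightarrow> nat \<Rightarrow> 'a ^ 'n" where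
  "vec_power x k = (\<chi> i. (x $ i) ^ k)"

definition positive_vec :: "real ^ 'n \<Rightarrow> bool" where
  "positive_vec x \<longleftrightarrow> (\<forall>i. x $ i > 0)"

definition nonneg_tensor :: "nat \<Rightarrow> 'n tensor \<Rightarrow> bool" where
  "nonneg_tensor m A \<longleftrightarrow> (\<forall>is. length is = m \<longrightarrow> A is \<ge> 0)"

definition identity_tensor :: "'n tensor" where
  "identity_tensor is = (if \<forall>i\<in>set is. \<forall>j\<in>set is. i = j then 1 else 0)"

definition eigenpair :: "nat \<Rightarrow> 'n::finite tensor \<Rightarrow> complex \<Rightarrow> complex ^ 'n \<Rightarrow> bool" where
  "eigenpair m A l x \<longleftrightarrow> x \<noteq> 0 \<and> tensor_app m A x = l *s vec_power x (m - 1)"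

definition eigenvalue :: "nat \<Rightarrow> 'n::finite tensor \<Rightarrow> complex \<Rightarrow> bool" where
  "eigenvalue m A l \<longleftrightarrow> (\<exists>x. eigenpair m A l x)"

text \<open>
  The maximum is written with \<^const>\<open>Greatest\<close>: \<^const>\<open>Max\<close> would presuppose that
  the set of moduli is finite.
\<close>

definition spectral_radius :: "nat \<Rightarrow> 'n::finite tensor \<Rightarrow> real" where
  "spectral_radius m A = (GREATEST r. \<exists>l. eigenvalue m A l \<and> r = cmod l)"

definition nonsingular_M_tensor :: "nat \<Rightarrow> 'n::finite tensor \<Rightarrow> bool" where
  "nonsingular_M_tensor m A \<longleftrightarrow>
     (\<exists>s B. nonneg_tensor m B \<and> s > spectral_radius m B \<and>
        (\<forall>is. length is = m \<longrightarrow> A is = s * identity_tensor is - B is))"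

definition homotopy_map ::
    "nat \<Rightarrow> 'n::finite tensor \<Rightarrow> real ^ 'n \<Rightarrow> real ^ 'n \<Rightarrow> real \<Rightarrow> real ^ 'n" where
  "homotopy_map m A b x t =
     (1 - t) *\<^sub>R (tensor_app m identity_tensor x - b) + t *\<^sub>R (tensor_app m A x - b)"

definition initial_point :: "nat \<Rightarrow> real ^ 'n \<Rightarrow> real ^ 'n" where
  "initial_point m b = (\<chi> i. (b $ i) powr (1 / real (m - 1)))"

text \<open>Derivatives of all orders within \<open>S\<close> (one-sided at the end points of an interval);
  \<open>D k\<close> is the \<open>k\<close>-th derivative.\<close>

definition smooth_curve_on :: "real set \<Rightarrow> (real \<Rightarrow> 'a::real_normed_vector) \<Rightarrow> bool" where
  "smooth_curve_on S f \<longleftrightarrow>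
     (\<exists>D. D 0 = f \<and>
        (\<forall>k::nat. \<forall>t\<in>S. (D k has_vector_derivative D (Suc k) t) (at t within S)))"

definition solution_curve ::
    "nat \<Rightarrow> 'n::finite tensor \<Rightarrow> real ^ 'n \<Rightarrow> (real \<Rightarrow> real ^ 'n) \<Rightarrow> bool" where
  "solution_curve m A b x \<longleftrightarrow>
     smooth_curve_on {0..1} x \<and> x 0 = initial_point m b \<and>
     (\<forall>t\<in>{0..1}. positive_vec (x t) \<and> homotopy_map m A b (x t) t = 0)"

definition positive_solution :: "nat \<Rightarrow> 'n::finite tensor \<Rightarrow> real ^ 'n \<Rightarrow> real ^ 'n \<Rightarrow> bool" where
  "positive_solution m A b x \<longleftrightarrow> positive_vec x \<and> tensor_app m A x = b"

lemma tensor_app_identity: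
  fixes x :: "'a::real_normed_field ^ 'n::finite"
  shows "tensor_app m identity_tensor x = vec_power x (m - 1)"
proof -
  have "(\<Sum>js | length js = m - 1. of_real (identity_tensor (i # js)) * (\<Prod>j\<leftarrow>js. x $ j))
      = (x $ i) ^ (m - 1)" for i
  proof -
    have fin: "finite {js :: 'n list. length js = m - 1}"
      using finite_lists_length_eq[of "UNIV :: 'n set" "m - 1"] by simp
    have "(\<Sum>js | length js = m - 1. of_real (identity_tensor (i # js)) * (\<Prod>j\<leftarrow>js. x $ j))
        = (\<Sum>js | length js = m - 1.
            if js = replicate (m - 1) i then (x $ i) ^ (m - 1) else 0)"
    proof (rule sum.cong)
      fix js :: "'n list"
      assume "js \<in> {js. length js = m - 1}"
      then have len: "length js = m - 1" by simp
      show "of_real (identity_tensor (i # js)) * (\<Prod>j\<leftarrow>js. x $ j)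
          = (if js = replicate (m - 1) i then (x $ i) ^ (m - 1) else 0)"
      proof (cases "\<forall>j\<in>set js. j = i")
        case True
        then have "js = replicate (m - 1) i"
          using len by (metis replicate_length_same)
        then show ?thesis
          by (simp add: identity_tensor_def)
      next
        case False
        then have "js \<noteq> replicate (m - 1) i" by auto
        then show ?thesis
          using False by (auto simp: identity_tensor_def)
      qed
    qed simp
    also have "\<dots> = (x $ i) ^ (m - 1)"
      using fin by (simp add: sum.delta)
    finally show ?thesis .
  qed
  then show ?thesis
    by (simp add: tensor_app_def vec_power_def)
qed

end

theory Submission
  imports Defs
begin

text \<open>
  Write $\mathcal{A} = s\mathcal{I} - \mathcal{B}$ with $\mathcal{B} \ge 0$ and
  $s > \rho(\mathcal{B})$. The spectral radius is used only once, to find a positive vector $v$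
  with $\mathcal{A}v^{m-1} > 0$ (\<open>semipositive_of_spectral_radius\<close>). For $\varepsilon > 0$, Brouwer's
  theorem on the simplex gives a positive $x$ with
  $\mathcal{B}x^{m-1} + \varepsilon = \lambda x^{[m-1]}$. As $\varepsilon \to 0$, limit points of these
  $\lambda$ are eigenvalues of $\mathcal{B}$, hence at most $\rho(\mathcal{B})$, so $\lambda < s$ for some
  $\varepsilon$, and then $v = x$ will do.

  For each \<open>t\<close> in the unit interval the homotopy equation is a system
  $\mathcal{A}_t x^{m-1} = b$, where
  $\mathcal{A}_t = (1 - t + ts)\mathcal{I} - t\mathcal{B}$ has the same shape and satisfies
  $\mathcal{A}_t v^{m-1} > 0$. Such a system has a positive solution by Brouwer's theorem on a box
  between \<open>0\<close> and a multiple of $v$ (\<open>Z_solution_exists\<close>), and only one, by comparing two solutions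
  at an index where their ratio is largest (\<open>Z_solution_unique\<close>). This determines the
  curve \<open>x\<close>, and what remains is its smoothness.

  Linearising the uniqueness argument shows that the derivative in the space variables is injective
  along the curve (\<open>Z_tensor_deriv_injective\<close>), so the inverse function theorem makes \<open>x\<close>
  differentiable (\<open>implicit_curve_differentiable\<close>). Its velocity solves a linear system with
  coefficients polynomial in \<open>x\<close> and \<open>t\<close>, hence, by Cramer's rule, belongs to the ring \<open>R\<close> of
  functions obtained from \<open>t\<close>, the components of \<open>x\<close> and the constants by sums, products and
  inverses of nowhere vanishing functions. So \<open>R\<close> is closed under differentiation, and derivatives
  of all orders exist (\<open>smooth_curve_on_rational_closure\<close>).
\<close>

section \<open>Tensors as polynomial maps\<close>

lemma tensor_app_nth:
  "tensor_app m A x $ i = (\<Sum>js | length js = m - 1. of_real (A (i # js)) * (\<Prod>j\<leftarrow>js. x $ j))"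
  by (simp add: tensor_app_def)

lemma tensor_app_scaleR:
  fixes x :: "'a::real_normed_field ^ 'n::finite"
  shows "tensor_app m A (c *\<^sub>R x) = c ^ (m - 1) *\<^sub>R tensor_app m A x"
proof -
  have "(\<Prod>j\<leftarrow>js. (c *\<^sub>R x) $ j) = c ^ length js *\<^sub>R (\<Prod>j\<leftarrow>js. x $ j)" for js
    by (induction js) simp_all
  then show ?thesis
    by (simp add: vec_eq_iff tensor_app_nth scaleR_sum_right)
qed

lemma continuous_on_tensor_app [continuous_intros]:
  fixes f :: "'b::topological_space \<Rightarrow> 'a::real_normed_field ^ 'n::finite"
  assumes "continuous_on S f"
  shows "continuous_on S (\<lambda>p. tensor_app m A (f p))"
proof -
  have "continuous_on S (\<lambda>p. \<Prod>j\<leftarrow>js. f p $ j)" for js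
    by (induction js) (auto intro!: continuous_intros assms)
  then show ?thesis
    unfolding tensor_app_def by (intro continuous_intros)
qed

text \<open>The spectral radius is defined by complex eigenvectors, while the Perron--Frobenius argument below
  produces real ones; this identity turns the latter into the former.\<close>

lemma tensor_app_of_real:
  fixes x :: "real ^ 'n::finite"
  shows "tensor_app m A (\<chi> i. complex_of_real (x $ i)) = (\<chi> i. complex_of_real (tensor_app m A x $ i))"
proof -
  have "(\<Prod>j\<leftarrow>js. complex_of_real (x $ j)) = complex_of_real (\<Prod>j\<leftarrow>js. x $ j)" for js
    by (induction js) simp_all
  then show ?thesis
    by (simp add: vec_eq_iff tensor_app_nth)
qed

lemma prod_list_map_nonneg:
  fixes f :: "'n \<Rightarrow> real"
  assumes "\<And>j. 0 \<le> f j"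
  shows "0 \<le> (\<Prod>j\<leftarrow>js. f j)"
  by (induction js) (simp_all add: assms)

lemma tensor_app_nonneg:
  fixes x :: "real ^ 'n::finite"
  assumes "nonneg_tensor m B" "m \<ge> 1" "\<And>j. 0 \<le> x $ j"
  shows "0 \<le> tensor_app m B x $ i"
proof -
  have "0 \<le> B (i # js)" if "length js = m - 1" for js
    using assms that by (simp add: nonneg_tensor_def)
  then show ?thesis
    unfolding tensor_app_nth
    by (intro sum_nonneg) (auto intro!: mult_nonneg_nonneg prod_list_map_nonneg assms)
qed

lemma tensor_app_mono:
  fixes x y :: "real ^ 'n::finite"
  assumes "nonneg_tensor m B" "m \<ge> 1" "\<And>j. 0 \<le> x $ j" "\<And>j. x $ j \<le> y $ j"
  shows "tensor_app m B x $ i \<le> tensor_app m B y $ i"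
proof -
  have y: "0 \<le> y $ j" for j using assms(3,4) order_trans by blast
  have "(\<Prod>j\<leftarrow>js. x $ j) \<le> (\<Prod>j\<leftarrow>js. y $ j)" for js
    by (induction js) (auto intro!: mult_mono assms prod_list_map_nonneg y)
  moreover have "0 \<le> B (i # js)" if "length js = m - 1" for js
    using assms that by (simp add: nonneg_tensor_def)
  ultimately show ?thesis
    unfolding tensor_app_nth by (auto intro!: sum_mono mult_left_mono)
qed

section \<open>Z-tensors\<close>

text \<open>The scalar \<open>s\<close> is arbitrary: how it compares with the spectral radius of \<open>B\<close> is expressed
  separately, by a positive vector \<open>v\<close> with \<^term>\<open>positive_vec (tensor_app m A v)\<close>. In this form
  the hypothesis passes from a nonsingular M-tensor to the whole homotopy.\<close>

definition Z_splitting :: "nat \<Rightarrow> real \<Rightarrow> 'n tensor \<Rightarrow> 'n tensor \<Rightarrow> bool" where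
  "Z_splitting m s B A \<longleftrightarrow>
     nonneg_tensor m B \<and> (\<forall>is. length is = m \<longrightarrow> A is = s * identity_tensor is - B is)"

lemma Z_splitting_app:
  fixes x :: "real ^ 'n::finite"
  assumes "Z_splitting m s B A" "m \<ge> 1"
  shows "tensor_app m A x $ i = s * (x $ i) ^ (m - 1) - tensor_app m B x $ i"
proof -
  have "A (i # js) = s * identity_tensor (i # js) - B (i # js)" if "length js = m - 1" for js
    using assms that by (simp add: Z_splitting_def)
  then have "tensor_app m A x $ i = s * tensor_app m identity_tensor x $ i - tensor_app m B x $ i"
    unfolding tensor_app_nth sum_distrib_left sum_subtractf[symmetric]
    by (intro sum.cong) (simp_all add: left_diff_distrib mult.assoc)
  then show ?thesis
    by (simp add: tensor_app_identity vec_power_def)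
qed

text \<open>Compare two positive solutions at an index where the ratio \<^term>\<open>x $ i / y $ i\<close> is largest.
  If this ratio \<open>\<theta>\<close> exceeded \<open>1\<close>, the off-diagonal part would grow by at most
  $\theta^{m-1}$ and the right-hand side not at all, so the diagonal term could not grow by
  $\theta^{m-1}$.\<close>

lemma Z_solution_le:
  fixes x y :: "real ^ 'n::finite"
  assumes Z: "Z_splitting m s B A" and m: "m \<ge> 2"
    and x: "positive_vec x" "tensor_app m A x = b"
    and y: "positive_vec y" "tensor_app m A y = b"
    and b: "positive_vec b"
  shows "x $ i \<le> y $ i"
proof (rule ccontr)
  assume contra: "\<not> x $ i \<le> y $ i"
  have xp: "x $ j > 0" and yp: "y $ j > 0" and bp: "b $ j > 0" for j
    using assms by (auto simp: positive_vec_def)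
  define \<theta> where "\<theta> = Max (range (\<lambda>j. x $ j / y $ j))"
  have "\<theta> \<in> range (\<lambda>j. x $ j / y $ j)"
    unfolding \<theta>_def by (intro Max_in) auto
  then obtain k where k: "\<theta> = x $ k / y $ k" by auto
  have max: "x $ j / y $ j \<le> \<theta>" for j
    unfolding \<theta>_def by (intro Max_ge) auto
  have "1 < x $ i / y $ i" using contra yp[of i] by simp
  with max[of i] have th: "\<theta> > 1" by linarith
  have th1: "\<theta> ^ (m - 1) > 1" using th m by (intro one_less_power) auto
  have "x $ j \<le> (\<theta> *\<^sub>R y) $ j" for j
    using max[of j] yp[of j] by (simp add: divide_le_eq)
  then have "tensor_app m B x $ k \<le> tensor_app m B (\<theta> *\<^sub>R y) $ k"
    using Z m xp by (intro tensor_app_mono) (auto simp: Z_splitting_def less_imp_le)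
  then have B: "tensor_app m B x $ k \<le> \<theta> ^ (m - 1) * tensor_app m B y $ k"
    by (simp add: tensor_app_scaleR)
  have "x $ k = \<theta> * y $ k" using k yp[of k] by simp
  then have "s * (x $ k) ^ (m - 1) = \<theta> ^ (m - 1) * (s * (y $ k) ^ (m - 1))"
    by (simp add: power_mult_distrib)
  then have diag: "\<theta> ^ (m - 1) * (s * (y $ k) ^ (m - 1)) = s * (x $ k) ^ (m - 1)" by (rule sym)
  have xk: "b $ k = s * (x $ k) ^ (m - 1) - tensor_app m B x $ k"
    and yk: "b $ k = s * (y $ k) ^ (m - 1) - tensor_app m B y $ k"
    using Z_splitting_app[OF Z, of x k] Z_splitting_app[OF Z, of y k] m x(2) y(2) by auto
  have "\<theta> ^ (m - 1) * b $ k
      = s * (x $ k) ^ (m - 1) - \<theta> ^ (m - 1) * tensor_app m B y $ k"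
    unfolding yk right_diff_distrib diag ..
  also have "\<dots> \<le> b $ k" using B xk by simp
  finally have "\<theta> ^ (m - 1) * b $ k \<le> b $ k" .
  with th1 bp[of k] show False by simp
qed

lemma Z_solution_unique:
  fixes x y :: "real ^ 'n::finite"
  assumes "Z_splitting m s B A" "m \<ge> 2"
    and "positive_solution m A b x" "positive_solution m A b y" and "positive_vec b"
  shows "x = y"
  using assms Z_solution_le[of m s B A x b y] Z_solution_le[of m s B A y b x]
  by (auto simp: vec_eq_iff positive_solution_def intro!: antisym)

text \<open>A positive vector \<open>v\<close> with positive image can be scaled so that its image dominates \<open>b\<close>.
  The box between \<open>0\<close> and the scaled vector is then mapped into itself by
  $x \mapsto ((b + \mathcal{B}x^{m-1})/s)^{[1/(m-1)]}$, and the fixed points of this map solve the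
  system.\<close>

lemma Z_solution_exists:
  fixes b v :: "real ^ 'n::finite"
  assumes Z: "Z_splitting m s B A" and m: "m \<ge> 2"
    and v: "positive_vec v" "positive_vec (tensor_app m A v)"
    and b: "positive_vec b"
  shows "\<exists>x. positive_solution m A b x"
proof -
  have vp: "v $ j > 0" and Avp: "tensor_app m A v $ j > 0" and bp: "b $ j > 0" for j
    using assms by (auto simp: positive_vec_def)
  have nnB: "nonneg_tensor m B" using Z by (simp add: Z_splitting_def)
  \<comment> \<open>Large enough to dominate every ratio $b_j / (\mathcal{A}v^{m-1})_j$, and at least \<open>1\<close> so that
    its power \<open>m - 1\<close> does so as well.\<close>
  define c where "c = 1 + (\<Sum>j\<in>UNIV. b $ j / tensor_app m A v $ j)"
  have c1: "c \<ge> 1"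
    unfolding c_def using bp Avp by (simp add: sum_nonneg less_imp_le)
  define w where "w = c *\<^sub>R v"
  have wp: "w $ j > 0" for j using vp[of j] c1 by (simp add: w_def)
  have Aw: "b $ j \<le> tensor_app m A w $ j" for j
  proof -
    have "b $ j / tensor_app m A v $ j \<le> (\<Sum>j\<in>UNIV. b $ j / tensor_app m A v $ j)"
      using bp Avp by (intro member_le_sum) (auto simp: less_imp_le)
    then have "b $ j / tensor_app m A v $ j \<le> c" by (simp add: c_def)
    also have "c \<le> c ^ (m - 1)" using c1 m by (intro self_le_power) auto
    finally have "b $ j \<le> c ^ (m - 1) * tensor_app m A v $ j"
      using Avp[of j] by (simp add: divide_le_eq)
    then show ?thesis by (simp add: w_def tensor_app_scaleR)
  qed
  have m1: "m - 1 > 0" using m by simp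
  have Bw: "b $ j + tensor_app m B w $ j \<le> s * (w $ j) ^ (m - 1)" for j
    using Aw[of j] Z_splitting_app[OF Z, of w j] m by simp
  have s: "s > 0"
  proof -
    obtain j :: 'n where True by simp
    have "0 \<le> tensor_app m B w $ j"
      using nnB m wp by (intro tensor_app_nonneg) (auto simp: less_imp_le)
    then have "0 < s * (w $ j) ^ (m - 1)" using Bw[of j] bp[of j] by linarith
    then show ?thesis using wp[of j] by (simp add: zero_less_mult_iff not_less)
  qed
  define T where "T x = (\<chi> j. root (m - 1) ((b $ j + tensor_app m B x $ j) / s))" for x :: "real ^ 'n"
  have "\<exists>x\<in>cbox 0 w. T x = x"
  proof (rule brouwer[of "cbox 0 w" T])
    show "cbox 0 w \<noteq> {}"
      using wp by (auto simp: interval_ne_empty_cart less_imp_le)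
    show "continuous_on (cbox 0 w) T"
      unfolding T_def by (intro continuous_intros) (use s in auto)
    show "T \<in> cbox 0 w \<rightarrow> cbox 0 w"
    proof
      fix x assume "x \<in> cbox 0 w"
      then have x: "0 \<le> x $ j" "x $ j \<le> w $ j" for j by (auto simp: mem_box_cart)
      have "0 \<le> T x $ j \<and> T x $ j \<le> w $ j" for j
      proof
        have "0 \<le> tensor_app m B x $ j"
          using nnB m x by (intro tensor_app_nonneg) auto
        then show "0 \<le> T x $ j" using bp[of j] s m1 by (simp add: T_def)
        have "tensor_app m B x $ j \<le> tensor_app m B w $ j"
          using nnB m x by (intro tensor_app_mono) auto
        then have "(b $ j + tensor_app m B x $ j) / s \<le> (w $ j) ^ (m - 1)"
          using Bw[of j] s by (simp add: divide_le_eq mult.commute)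
        then have "T x $ j \<le> root (m - 1) ((w $ j) ^ (m - 1))"
          unfolding T_def using m1 by (simp add: real_root_le_mono)
        then show "T x $ j \<le> w $ j"
          using m1 wp[of j] by (simp add: real_root_power_cancel)
      qed
      then show "T x \<in> cbox 0 w" by (simp add: mem_box_cart)
    qed
  qed auto
  then obtain x where x: "x \<in> cbox 0 w" "T x = x" by blast
  have xnn: "0 \<le> x $ j" for j using x(1) by (auto simp: mem_box_cart)
  have rhs: "(b $ j + tensor_app m B x $ j) / s > 0" for j
    using tensor_app_nonneg[OF nnB _ xnn, of j] m bp[of j] s by simp
  have xT: "x $ j = root (m - 1) ((b $ j + tensor_app m B x $ j) / s)" for j
    using x(2) by (metis T_def vec_lambda_beta)
  have "x $ j > 0" for j using rhs[of j] m1 by (subst xT) simp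
  moreover have "tensor_app m A x $ j = b $ j" for j
  proof -
    have "(x $ j) ^ (m - 1) = (b $ j + tensor_app m B x $ j) / s"
      using rhs[of j] m1 by (subst xT) (simp add: real_root_pow_pos2)
    then have "s * (x $ j) ^ (m - 1) = b $ j + tensor_app m B x $ j"
      using s by simp
    then show ?thesis using Z_splitting_app[OF Z, of x j] m by simp
  qed
  ultimately show ?thesis
    by (auto simp: positive_solution_def positive_vec_def vec_eq_iff)
qed

section \<open>Spectral radius and semipositivity\<close>

lemma modulus_of_eigenpair:
  assumes "eigenpair m A l x"
  shows "cmod l = (\<Sum>i\<in>UNIV. cmod (tensor_app m A x $ i)) / (\<Sum>i\<in>UNIV. cmod (x $ i) ^ (m - 1))"
    and "(\<Sum>i\<in>UNIV. cmod (x $ i) ^ (m - 1)) > 0"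
proof -
  have "x \<noteq> 0" and eq: "tensor_app m A x = l *s vec_power x (m - 1)"
    using assms by (auto simp: eigenpair_def)
  then obtain j where "x $ j \<noteq> 0" by (auto simp: vec_eq_iff)
  then show pos: "(\<Sum>i\<in>UNIV. cmod (x $ i) ^ (m - 1)) > 0"
    by (intro sum_pos2[of _ j]) auto
  have "cmod (tensor_app m A x $ i) = cmod l * cmod (x $ i) ^ (m - 1)" for i
    by (simp add: eq vec_power_def norm_mult norm_power)
  then show "cmod l = (\<Sum>i\<in>UNIV. cmod (tensor_app m A x $ i)) / (\<Sum>i\<in>UNIV. cmod (x $ i) ^ (m - 1))"
    using pos by (simp flip: sum_distrib_left)
qed

text \<open>The maximum in the definition of the spectral radius is attained: the modulus of the
  eigenvalue is a continuous function of the eigenvector, and the eigenvectors in the unit sphere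
  form a compact set, being cut out by the cross-multiplied equations
  $(\mathcal{A}x^{m-1})_i x_j^{m-1} = (\mathcal{A}x^{m-1})_j x_i^{m-1}$, which do not mention the
  eigenvalue.\<close>

lemma eigenvalue_le_spectral_radius:
  fixes A :: "'n::finite tensor"
  assumes "eigenvalue m A l"
  shows "cmod l \<le> spectral_radius m A"
proof -
  define \<phi> where "\<phi> x = (\<Sum>i\<in>UNIV. cmod (tensor_app m A x $ i)) / (\<Sum>i\<in>UNIV. cmod (x $ i) ^ (m - 1))"
    for x :: "complex ^ 'n"
  define E where "E = sphere (0 :: complex ^ 'n) 1 \<inter>
    (\<Inter>i. \<Inter>j. {x. tensor_app m A x $ i * (x $ j) ^ (m - 1) = tensor_app m A x $ j * (x $ i) ^ (m - 1)})"
  have E_eigen: "eigenpair m A (tensor_app m A x $ k / (x $ k) ^ (m - 1)) x"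
    if "x \<in> E" "x $ k \<noteq> 0" for x k
  proof -
    have "tensor_app m A x $ i * (x $ k) ^ (m - 1) = tensor_app m A x $ k * (x $ i) ^ (m - 1)" for i
      using that by (auto simp: E_def)
    then show ?thesis
      using that by (auto simp: eigenpair_def vec_eq_iff vec_power_def field_simps)
  qed
  have E_ex: "\<exists>l. eigenpair m A l x" if "x \<in> E" for x
  proof -
    have "x \<noteq> 0" using that by (auto simp: E_def)
    then obtain k where "x $ k \<noteq> 0" by (auto simp: vec_eq_iff)
    with E_eigen that show ?thesis by blast
  qed
  have moduli: "{r. \<exists>l. eigenvalue m A l \<and> r = cmod l} = \<phi> ` E"
  proof (intro equalityI subsetI)
    fix r assume "r \<in> {r. \<exists>l. eigenvalue m A l \<and> r = cmod l}"
    then obtain l x where l: "eigenpair m A l x" "r = cmod l" by (auto simp: eigenvalue_def)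
    then have x0: "x \<noteq> 0" by (simp add: eigenpair_def)
    define y where "y = (1 / norm x) *\<^sub>R x"
    have eq: "tensor_app m A y = l *s vec_power y (m - 1)"
      using l(1) by (simp add: eigenpair_def y_def tensor_app_scaleR vec_eq_iff vec_power_def scaleR_power)
    then have "eigenpair m A l y"
      using x0 by (simp add: eigenpair_def y_def)
    then have "r = \<phi> y" using modulus_of_eigenpair(1) l(2) by (simp add: \<phi>_def)
    moreover have "y \<in> E"
      using x0 eq by (simp add: E_def y_def[symmetric] vec_power_def) (simp add: y_def)
    ultimately show "r \<in> \<phi> ` E" by blast
  next
    fix r assume "r \<in> \<phi> ` E"
    then show "r \<in> {r. \<exists>l. eigenvalue m A l \<and> r = cmod l}"
      using E_ex modulus_of_eigenpair(1) by (fastforce simp: eigenvalue_def \<phi>_def)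
  qed
  have "compact E"
    unfolding E_def
    by (intro compact_Int_closed closed_INT ballI closed_Collect_eq continuous_intros) auto
  moreover have "continuous_on E \<phi>"
    unfolding \<phi>_def
    by (intro continuous_intros ballI) (use E_ex modulus_of_eigenpair(2) in fastforce)
  moreover have "cmod l \<in> \<phi> ` E"
    using assms by (auto simp flip: moduli)
  ultimately obtain r where r: "r \<in> \<phi> ` E" "\<forall>q\<in>\<phi> ` E. q \<le> r"
    using compact_attains_sup[of "\<phi> ` E"] compact_continuous_image by blast
  then have "spectral_radius m A = r"
    unfolding spectral_radius_def
    by (intro Greatest_equality) (auto simp flip: moduli)
  moreover have "cmod l \<le> r" using r(2) \<open>cmod l \<in> \<phi> ` E\<close> by blast
  ultimately show ?thesis by simp
qed

definition unit_simplex :: "(real ^ 'n::finite) set" where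
  "unit_simplex = {x. (\<forall>i. 0 \<le> x $ i) \<and> (\<Sum>i\<in>UNIV. x $ i) = 1}"

lemma unit_simplex_nonzero:
  assumes "x \<in> unit_simplex"
  obtains j where "x $ j > 0"
proof -
  have "\<exists>j. x $ j \<noteq> 0"
  proof (rule ccontr)
    assume "\<not> ?thesis"
    then have "(\<Sum>i\<in>UNIV. x $ i) = 0" by simp
    with assms show False by (simp add: unit_simplex_def)
  qed
  with assms show thesis by (auto simp: unit_simplex_def less_le intro: that)
qed

lemma convex_unit_simplex: "convex (unit_simplex :: (real ^ 'n::finite) set)"
  by (rule convexI) (auto simp: unit_simplex_def sum.distrib simp flip: sum_distrib_left)

lemma compact_unit_simplex: "compact (unit_simplex :: (real ^ 'n::finite) set)"
proof -
  have "unit_simplex \<subseteq> cbox 0 (1 :: real ^ 'n)"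
  proof
    fix x :: "real ^ 'n" assume x: "x \<in> unit_simplex"
    have "x $ i \<le> (\<Sum>i\<in>UNIV. x $ i)" for i
      using x by (intro member_le_sum) (auto simp: unit_simplex_def)
    with x show "x \<in> cbox 0 1" by (auto simp: unit_simplex_def mem_box_cart)
  qed
  moreover have "closed (unit_simplex :: (real ^ 'n) set)"
    unfolding unit_simplex_def
    by (intro closed_Collect_conj closed_Collect_all closed_Collect_le closed_Collect_eq
        continuous_intros)
  ultimately show ?thesis
    using bounded_subset[OF bounded_cbox] compact_eq_bounded_closed by blast
qed

lemma unit_simplex_nonempty: "(unit_simplex :: (real ^ 'n::finite) set) \<noteq> {}"
proof -
  have "(\<chi> i. 1 / real CARD('n)) \<in> (unit_simplex :: (real ^ 'n) set)"
    by (simp add: unit_simplex_def)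
  then show ?thesis by blast
qed

text \<open>Perron--Frobenius for a perturbed tensor, by Brouwer's theorem on the simplex: there the
  constant \<open>e\<close> agrees with the value of \<open>e\<close> times the all-ones tensor, so this is a positive
  eigenvector of a tensor with positive entries.\<close>

lemma perturbed_eigenvector:
  fixes B :: "'n::finite tensor"
  assumes B: "nonneg_tensor m B" and m: "m \<ge> 2" and e: "e > 0"
  obtains x :: "real ^ 'n" and l where "x \<in> unit_simplex" "positive_vec x"
    "\<And>i. tensor_app m B x $ i + e = l * (x $ i) ^ (m - 1)"
proof -
  have m1: "m - 1 > 0" using m by simp
  define g where "g x i = root (m - 1) (tensor_app m B x $ i + e)" for x :: "real ^ 'n" and i
  define T where "T x = (\<chi> i. g x i / (\<Sum>j\<in>UNIV. g x j))" for x
  have g: "g x i > 0" if "x \<in> unit_simplex" for x i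
    using tensor_app_nonneg[OF B, of x i] m e that
    by (simp add: g_def unit_simplex_def)
  then have sg: "(\<Sum>j\<in>UNIV. g x j) > 0" if "x \<in> unit_simplex" for x
    using that by (intro sum_pos) auto
  have "\<exists>x\<in>unit_simplex. T x = x"
  proof (rule brouwer[OF compact_unit_simplex convex_unit_simplex unit_simplex_nonempty, of T])
    have "continuous_on unit_simplex (\<lambda>x. g x i)" for i
      unfolding g_def by (intro continuous_intros)
    then show "continuous_on unit_simplex T"
      unfolding T_def using sg by (intro continuous_intros) fastforce+
    show "T \<in> unit_simplex \<rightarrow> unit_simplex"
    proof
      fix x :: "real ^ 'n" assume x: "x \<in> unit_simplex"
      show "T x \<in> unit_simplex"
        using g[OF x] sg[OF x]
        by (simp add: unit_simplex_def T_def less_imp_le flip: sum_divide_distrib)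
    qed
  qed auto
  then obtain x where x: "x \<in> unit_simplex" "T x = x" by blast
  define \<sigma> where "\<sigma> = (\<Sum>j\<in>UNIV. g x j)"
  have s: "\<sigma> > 0" using sg[OF x(1)] by (simp add: \<sigma>_def)
  have xi: "x $ i = g x i / \<sigma>" for i
    using x(2) by (metis T_def \<sigma>_def vec_lambda_beta)
  have "x $ i > 0" for i using g[OF x(1)] s by (subst xi) simp
  moreover have "tensor_app m B x $ i + e = \<sigma> ^ (m - 1) * (x $ i) ^ (m - 1)" for i
  proof -
    have "\<sigma> ^ (m - 1) * (x $ i) ^ (m - 1) = (g x i) ^ (m - 1)"
      using s by (subst xi) (simp add: power_divide)
    also have "\<dots> = tensor_app m B x $ i + e"
      using m1 e tensor_app_nonneg[OF B, of x i] m x(1)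
      by (simp add: g_def unit_simplex_def)
    finally show ?thesis by simp
  qed
  ultimately show thesis
    using that x(1) by (auto simp: positive_vec_def)
qed

text \<open>If the perturbed eigenvalue stayed at least \<open>s\<close> as the perturbation tends to \<open>0\<close>, then a
  limit point of the eigenvectors would be a nonnegative eigenvector of \<open>B\<close> for an eigenvalue at
  least \<open>s\<close>. Hence \<open>s\<close> exceeds some perturbed eigenvalue, and its eigenvector is as desired.\<close>

lemma semipositive_of_spectral_radius:
  fixes B :: "'n::finite tensor"
  assumes B: "nonneg_tensor m B" and m: "m \<ge> 2" and s: "spectral_radius m B < s"
  obtains v :: "real ^ 'n" where "positive_vec v" "\<And>i. tensor_app m B v $ i < s * (v $ i) ^ (m - 1)"
proof -
  define e where "e k = inverse (real (Suc k))" for k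
  have e: "e k > 0" for k by (simp add: e_def)
  have "\<exists>x l. x \<in> unit_simplex \<and> positive_vec x \<and>
      (\<forall>i. tensor_app m B x $ i + e k = l * (x $ i) ^ (m - 1))" for k
    using perturbed_eigenvector[OF B m e] by metis
  then obtain x :: "nat \<Rightarrow> real ^ 'n" and l where x: "x k \<in> unit_simplex" "positive_vec (x k)"
    and l: "tensor_app m B (x k) $ i + e k = l k * (x k $ i) ^ (m - 1)" for k i
    by metis
  have "\<exists>k. l k < s"
  proof (rule ccontr)
    assume "\<not> ?thesis"
    then have ls: "s \<le> l k" for k by (simp add: not_less)
    obtain y r where y: "y \<in> unit_simplex" "strict_mono r" "(x \<circ> r) \<longlonglongrightarrow> y"
      using compact_unit_simplex x(1) unfolding compact_def by metis
    have e0: "(\<lambda>k. e (r k)) \<longlonglongrightarrow> 0"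
      using LIMSEQ_subseq_LIMSEQ[OF LIMSEQ_inverse_real_of_nat y(2)] by (simp add: e_def o_def)
    have xy: "(\<lambda>k. x (r k)) \<longlonglongrightarrow> y" using y(3) by (simp add: o_def)
    have "continuous_on UNIV (\<lambda>x :: real ^ 'n. tensor_app m B x)"
      by (intro continuous_intros)
    then have Bxy: "(\<lambda>k. tensor_app m B (x (r k))) \<longlonglongrightarrow> tensor_app m B y"
      using xy by (auto intro: continuous_on_tendsto_compose)
    have pos: "(\<Sum>i\<in>UNIV. (z $ i) ^ (m - 1)) > 0" if z: "z \<in> unit_simplex" for z :: "real ^ 'n"
    proof -
      obtain j where "z $ j > 0" using unit_simplex_nonzero[OF z] .
      then show ?thesis using z by (intro sum_pos2[of _ j]) (auto simp: unit_simplex_def)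
    qed
    \<comment> \<open>Summing the eigenvalue equations expresses the eigenvalue as a continuous function of the
      eigenvector, so it converges along with it.\<close>
    define h where "h d z = (\<Sum>i\<in>UNIV. tensor_app m B z $ i + d) / (\<Sum>i\<in>UNIV. (z $ i) ^ (m - 1))"
      for d :: real and z :: "real ^ 'n"
    have lh: "l k = h (e k) (x k)" for k
      using pos[OF x(1), of k] by (simp add: h_def l flip: sum_distrib_left)
    have "(\<lambda>k. h (e (r k)) (x (r k))) \<longlonglongrightarrow> h 0 y"
      unfolding h_def using pos[OF y(1)] by (intro tendsto_intros e0 xy Bxy) auto
    then have lim: "(\<lambda>k. l (r k)) \<longlonglongrightarrow> h 0 y" by (simp add: lh)
    have hs: "s \<le> h 0 y"
      using LIMSEQ_le_const[OF lim] ls by blast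
    have eq: "tensor_app m B y $ i = h 0 y * (y $ i) ^ (m - 1)" for i
    proof (rule LIMSEQ_unique)
      show "(\<lambda>k. tensor_app m B (x (r k)) $ i + e (r k)) \<longlonglongrightarrow> tensor_app m B y $ i"
        using tendsto_add[OF tendsto_vec_nth[OF Bxy, of i] e0] by simp
      show "(\<lambda>k. tensor_app m B (x (r k)) $ i + e (r k)) \<longlonglongrightarrow> h 0 y * (y $ i) ^ (m - 1)"
        unfolding l by (intro tendsto_intros lim xy)
    qed
    obtain j where j: "y $ j > 0" using unit_simplex_nonzero[OF y(1)] .
    have "eigenpair m B (complex_of_real (h 0 y)) (\<chi> i. complex_of_real (y $ i))"
      using j eq by (auto simp: eigenpair_def tensor_app_of_real vec_eq_iff vec_power_def intro!: exI[of _ j])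
    then have "cmod (complex_of_real (h 0 y)) \<le> spectral_radius m B"
      using eigenvalue_le_spectral_radius eigenvalue_def by blast
    with hs s show False by simp
  qed
  then obtain k where k: "l k < s" by blast
  have "tensor_app m B (x k) $ i < s * (x k $ i) ^ (m - 1)" for i
  proof -
    have "tensor_app m B (x k) $ i < l k * (x k $ i) ^ (m - 1)"
      using l[of k i] e[of k] by linarith
    also have "\<dots> \<le> s * (x k $ i) ^ (m - 1)"
      using k x(2)[of k] by (intro mult_right_mono) (auto simp: positive_vec_def less_imp_le)
    finally show ?thesis .
  qed
  then show thesis using that x(2) by blast
qed

lemma nonsingular_M_tensor_semipositive:
  fixes A :: "'n::finite tensor"
  assumes "nonsingular_M_tensor m A" "m \<ge> 2"
  obtains s B and v :: "real ^ 'n" where "Z_splitting m s B A"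
    "positive_vec v" "positive_vec (tensor_app m A v)"
proof -
  obtain s B where Z: "Z_splitting m s B A" and s: "spectral_radius m B < s"
    using assms(1) by (auto simp: nonsingular_M_tensor_def Z_splitting_def)
  then obtain v :: "real ^ 'n" where "positive_vec v" "\<And>i. tensor_app m B v $ i < s * (v $ i) ^ (m - 1)"
    using semipositive_of_spectral_radius assms(2) by (metis Z_splitting_def)
  then show thesis
    using that[OF Z, of v] Z_splitting_app[OF Z] assms(2) by (simp add: positive_vec_def)
qed

section \<open>Differentiability of implicitly defined curves\<close>

text \<open>The inverse function theorem is applied to \<open>(y, t) \<mapsto> (F (y, t), t)\<close>. Uniqueness of the
  solutions in \<open>W\<close> identifies the given curve near \<open>t\<close> with a slice of the local inverse. The slice
  is differentiable on a full neighbourhood of \<open>t\<close>, so the curve has a derivative within \<open>S\<close> also when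
  \<open>t\<close> lies on the boundary of \<open>S\<close>.\<close>

lemma implicit_curve_differentiable:
  fixes F :: "'a::euclidean_space \<times> real \<Rightarrow> 'a" and x :: "real \<Rightarrow> 'a"
  assumes F: "\<And>p. (F has_derivative F' p) (at p)"
    and F'_cont: "\<And>h. continuous_on UNIV (\<lambda>p. F' p h)"
    and inj: "\<And>h. F' (x t, t) (h, 0) = 0 \<Longrightarrow> h = 0"
    and "open W" and x: "\<And>u. u \<in> S \<Longrightarrow> x u \<in> W \<and> F (x u, u) = 0"
    and uniq: "\<And>u y. u \<in> S \<Longrightarrow> y \<in> W \<Longrightarrow> F (y, u) = 0 \<Longrightarrow> y = x u"
    and t: "t \<in> S"
  shows "\<exists>x'. (x has_vector_derivative x') (at t within S)"
proof -
  define \<Phi> where "\<Phi> p = (F p, snd p)" for p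
  define \<Phi>' where "\<Phi>' p = Blinfun (\<lambda>h. (F' p h, snd h))" for p
  have deriv: "(\<Phi> has_derivative (\<lambda>h. (F' p h, snd h))) (at p)" for p
    unfolding \<Phi>_def by (intro has_derivative_Pair F has_derivative_snd has_derivative_ident)
  then have app: "blinfun_apply (\<Phi>' p) = (\<lambda>h. (F' p h, snd h))" for p
    unfolding \<Phi>'_def by (intro bounded_linear_Blinfun_apply has_derivative_bounded_linear)
  have cont: "continuous_on UNIV \<Phi>'"
    by (intro continuous_on_blinfun_componentwise) (auto simp: app intro!: continuous_intros F'_cont)
  let ?p = "(x t, t)"
  have "inj (blinfun_apply (\<Phi>' ?p))"
  proof (subst linear_injective_0)
    show "linear (blinfun_apply (\<Phi>' ?p))"
      by (simp add: blinfun.bounded_linear_right bounded_linear.linear)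
    show "\<forall>h. blinfun_apply (\<Phi>' ?p) h = 0 \<longrightarrow> h = 0"
      using inj by (auto simp: app prod_eq_iff)
  qed
  then obtain G where G: "linear G" "G \<circ> blinfun_apply (\<Phi>' ?p) = id"
    using linear_injective_left_inverse[of "blinfun_apply (\<Phi>' ?p)"]
    by (auto simp: blinfun.bounded_linear_right bounded_linear.linear)
  have "Blinfun G o\<^sub>L \<Phi>' ?p = id_blinfun"
    using G by (intro blinfun_eqI)
      (simp add: bounded_linear_Blinfun_apply linear_conv_bounded_linear pointfree_idE)
  moreover have "open (W \<times> (UNIV :: real set))" using \<open>open W\<close> by (intro open_Times) auto
  moreover have "?p \<in> W \<times> UNIV" using x[OF t] by simp
  ultimately obtain U V g g' where UV: "U \<subseteq> W \<times> UNIV" "open V" "\<Phi> ?p \<in> V" "homeomorphism U V \<Phi> g"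
    and g: "\<And>y. y \<in> V \<Longrightarrow> (g has_derivative g' y) (at y)"
    using inverse_function_theorem[of "W \<times> UNIV" \<Phi> \<Phi>' ?p "Blinfun G"]
      deriv[folded app] continuous_on_subset[OF cont subset_UNIV] by metis
  have base: "\<Phi> ?p = (0, t)" using x[OF t] by (simp add: \<Phi>_def)
  have "open ((\<lambda>u. (0 :: 'a, u)) -` V)"
    by (intro open_vimage continuous_intros) (rule UV)
  then obtain d where d: "d > 0" "\<And>u. dist u t < d \<Longrightarrow> (0, u) \<in> V"
    using UV(3) base by (auto simp: open_dist vimage_def)
  have slice: "fst (g (0, u)) = x u" if "u \<in> S" "dist u t < d" for u
  proof -
    have V: "(0, u) \<in> V" using d that by blast
    then have "\<Phi> (g (0, u)) = (0, u)" and "g (0, u) \<in> U"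
      using UV(4) by (auto simp: homeomorphism_def)
    then show ?thesis
      using uniq[OF that(1), of "fst (g (0, u))"] UV(1)
      by (cases "g (0, u)") (auto simp: \<Phi>_def)
  qed
  have "((\<lambda>u. (0 :: 'a, u)) has_derivative (\<lambda>h. (0, h))) (at t within S)"
    by (intro derivative_eq_intros) auto
  moreover have "(g has_derivative g' (0, t)) (at (0, t))"
    using g UV(3) base by simp
  ultimately have "((\<lambda>u. g (0, u)) has_derivative (\<lambda>h. g' (0, t) (0, h))) (at t within S)"
    by (rule has_derivative_compose)
  then have "((\<lambda>u. fst (g (0, u))) has_derivative (\<lambda>h. fst (g' (0, t) (0, h)))) (at t within S)"
    by (rule has_derivative_fst)
  then have "(x has_derivative (\<lambda>h. fst (g' (0, t) (0, h)))) (at t within S)"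
    using d(1) t slice by (rule has_derivative_transform_within)
  then have "x differentiable (at t within S)" by (auto simp: differentiable_def)
  then show ?thesis using vector_derivative_works by blast
qed

section \<open>Smoothness by closure under differentiation\<close>

text \<open>The ring generated by \<open>X\<close> and the constants, with inverses of the functions that vanish nowhere on
  \<open>S\<close>. If the derivatives of the generators belong to it, then so do those of all its members, and
  a single differentiability argument yields derivatives of all orders.\<close>

inductive_set rational_closure :: "real set \<Rightarrow> (real \<Rightarrow> real) set \<Rightarrow> (real \<Rightarrow> real) set"
  for S X where
  generator: "f \<in> X \<Longrightarrow> f \<in> rational_closure S X"
| const: "(\<lambda>t. c) \<in> rational_closure S X"
| add: "f \<in> rational_closure S X \<Longrightarrow> g \<in> rational_closure S X \<Longrightarrow>
    (\<lambda>t. f t + g t) \<in> rational_closure S X"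
| mult: "f \<in> rational_closure S X \<Longrightarrow> g \<in> rational_closure S X \<Longrightarrow>
    (\<lambda>t. f t * g t) \<in> rational_closure S X"
| inverse: "f \<in> rational_closure S X \<Longrightarrow> (\<forall>t\<in>S. f t \<noteq> 0) \<Longrightarrow>
    (\<lambda>t. inverse (f t)) \<in> rational_closure S X"

lemma rational_closure_uminus:
  "f \<in> rational_closure S X \<Longrightarrow> (\<lambda>t. - f t) \<in> rational_closure S X"
  using rational_closure.mult[OF rational_closure.const[of "-1"]] by simp

lemma rational_closure_diff:
  "f \<in> rational_closure S X \<Longrightarrow> g \<in> rational_closure S X \<Longrightarrow>
    (\<lambda>t. f t - g t) \<in> rational_closure S X"
  using rational_closure.add[OF _ rational_closure_uminus] by simp

lemma rational_closure_divide:
  "f \<in> rational_closure S X \<Longrightarrow> g \<in> rational_closure S X \<Longrightarrow> (\<forall>t\<in>S. g t \<noteq> 0) \<Longrightarrow>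
    (\<lambda>t. f t / g t) \<in> rational_closure S X"
  using rational_closure.mult[OF _ rational_closure.inverse] by (simp add: divide_inverse)

lemma rational_closure_sum:
  assumes "\<And>i. i \<in> I \<Longrightarrow> f i \<in> rational_closure S X"
  shows "(\<lambda>t. \<Sum>i\<in>I. f i t) \<in> rational_closure S X"
  using assms
  by (induction I rule: infinite_finite_induct)
    (auto intro: rational_closure.const rational_closure.add)

lemma rational_closure_prod:
  assumes "\<And>i. i \<in> I \<Longrightarrow> f i \<in> rational_closure S X"
  shows "(\<lambda>t. \<Prod>i\<in>I. f i t) \<in> rational_closure S X"
  using assms
  by (induction I rule: infinite_finite_induct)
    (auto intro: rational_closure.const rational_closure.mult)

lemma rational_closure_det:
  assumes "\<And>i j. (\<lambda>t. M t $ i $ j) \<in> rational_closure S X"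
  shows "(\<lambda>t. det (M t)) \<in> rational_closure S X"
  unfolding det_def
  by (intro rational_closure_sum rational_closure.mult rational_closure_prod assms
      rational_closure.const)

text \<open>By Cramer's rule the solution is a quotient of determinants, and the denominator vanishes nowhere
  on \<open>S\<close> by injectivity.\<close>

lemma rational_closure_linear_system:
  fixes M :: "real \<Rightarrow> real ^ 'n ^ 'n"
  assumes M: "\<And>i j. (\<lambda>t. M t $ i $ j) \<in> rational_closure S X"
    and c: "\<And>i. (\<lambda>t. c t $ i) \<in> rational_closure S X"
    and inj: "\<And>t h. t \<in> S \<Longrightarrow> M t *v h = 0 \<Longrightarrow> h = 0"
  shows "\<exists>y. (\<forall>i. (\<lambda>t. y t $ i) \<in> rational_closure S X) \<and>
    (\<forall>t\<in>S. \<forall>h. M t *v h = c t \<longrightarrow> h = y t)"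
proof -
  define y where "y t = (\<chi> k. det (\<chi> i j. if j = k then c t $ i else M t $ i $ j) / det (M t))" for t
  have det: "det (M t) \<noteq> 0" if "t \<in> S" for t
    using inj[OF that] by (metis invertible_det_nz matrix_left_invertible_ker invertible_left_inverse)
  have "(\<lambda>t. (if j = k then c t $ i else M t $ i $ j)) \<in> rational_closure S X" for i j k
    by (cases "j = k") (simp_all add: M c)
  then have "(\<lambda>t. y t $ i) \<in> rational_closure S X" for i
    unfolding y_def vec_lambda_beta using det
    by (intro rational_closure_divide rational_closure_det) (simp_all add: M)
  moreover have "h = y t" if "t \<in> S" "M t *v h = c t" for t h
    using cramer[OF det[OF that(1)]] that(2) by (simp add: y_def)
  ultimately show ?thesis by blast
qed

lemma rational_closure_has_derivative:
  assumes X: "\<And>f. f \<in> X \<Longrightarrow>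
      \<exists>f'\<in>rational_closure S X. \<forall>t\<in>S. (f has_real_derivative f' t) (at t within S)"
    and "f \<in> rational_closure S X"
  shows "\<exists>f'\<in>rational_closure S X. \<forall>t\<in>S. (f has_real_derivative f' t) (at t within S)"
  using assms(2)
proof induction
  case (const c)
  show ?case by (intro bexI[of _ "\<lambda>t. 0"]) (auto intro: rational_closure.const)
next
  case (add f g)
  then obtain f' g' where *: "f' \<in> rational_closure S X" "g' \<in> rational_closure S X"
    "\<forall>t\<in>S. (f has_real_derivative f' t) (at t within S)"
    "\<forall>t\<in>S. (g has_real_derivative g' t) (at t within S)" by blast
  then show ?case
    by (intro bexI[of _ "\<lambda>t. f' t + g' t"])
      (auto intro!: rational_closure.add derivative_eq_intros)
next
  case (mult f g)
  then obtain f' g' where *: "f' \<in> rational_closure S X" "g' \<in> rational_closure S X"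
    "\<forall>t\<in>S. (f has_real_derivative f' t) (at t within S)"
    "\<forall>t\<in>S. (g has_real_derivative g' t) (at t within S)" by blast
  with mult show ?case
    by (intro bexI[of _ "\<lambda>t. f' t * g t + g' t * f t"])
      (auto intro!: rational_closure.add rational_closure.mult derivative_eq_intros)
next
  case (inverse f)
  then obtain f' where *: "f' \<in> rational_closure S X"
    "\<forall>t\<in>S. (f has_real_derivative f' t) (at t within S)" by blast
  with inverse show ?case
    by (intro bexI[of _ "\<lambda>t. - (inverse (f t) * f' t * inverse (f t))"])
      (auto intro!: rational_closure_uminus rational_closure.mult rational_closure.inverse
        derivative_eq_intros)
qed (use X in blast)

lemma has_vector_derivative_vec_nth_iff:
  fixes f :: "real \<Rightarrow> real ^ 'n"
  shows "(f has_vector_derivative f') (at t within S) \<longleftrightarrow>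
    (\<forall>i. ((\<lambda>u. f u $ i) has_real_derivative f' $ i) (at t within S))"
proof
  assume "(f has_vector_derivative f') (at t within S)"
  then show "\<forall>i. ((\<lambda>u. f u $ i) has_real_derivative f' $ i) (at t within S)"
    using bounded_linear.has_vector_derivative[OF bounded_linear_vec_nth]
    by (auto simp: has_real_derivative_iff_has_vector_derivative)
next
  assume *: "\<forall>i. ((\<lambda>u. f u $ i) has_real_derivative f' $ i) (at t within S)"
  have "((\<lambda>u. \<Sum>i\<in>UNIV. f u $ i *\<^sub>R (axis i 1 :: real ^ 'n)) has_vector_derivative (\<Sum>i\<in>UNIV. f' $ i *\<^sub>R axis i 1))
      (at t within S)"
    using * by (auto intro!: has_vector_derivative_sum derivative_eq_intros)
  then show "(f has_vector_derivative f') (at t within S)"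
    using basis_expansion[where 'a = real and 'n = 'n] by (simp add: scalar_mult_eq_scaleR)
qed

text \<open>Choosing a derivative inside the closure turns differentiation into a self-map of the closure,
  so that it can be iterated.\<close>

lemma smooth_curve_on_rational_closure:
  fixes x :: "real \<Rightarrow> real ^ 'n"
  assumes X: "\<And>f. f \<in> X \<Longrightarrow>
      \<exists>f'\<in>rational_closure S X. \<forall>t\<in>S. (f has_real_derivative f' t) (at t within S)"
    and x: "\<And>i. (\<lambda>t. x t $ i) \<in> rational_closure S X"
  shows "smooth_curve_on S x"
proof -
  obtain der where der: "\<And>f. f \<in> rational_closure S X \<Longrightarrow> der f \<in> rational_closure S X \<and>
      (\<forall>t\<in>S. (f has_real_derivative der f t) (at t within S))"
    using rational_closure_has_derivative[OF X] by metis
  define D where "D k t = (\<chi> i. (der ^^ k) (\<lambda>t. x t $ i) t)" for k t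
  have "(der ^^ k) (\<lambda>t. x t $ i) \<in> rational_closure S X" for k i
    by (induction k) (use x der in auto)
  then have "(D k has_vector_derivative D (Suc k) t) (at t within S)" if "t \<in> S" for k t
    using der that by (simp add: has_vector_derivative_vec_nth_iff D_def)
  moreover have "D 0 = x" by (auto simp: D_def fun_eq_iff vec_eq_iff)
  ultimately show ?thesis unfolding smooth_curve_on_def by blast
qed

section \<open>The derivative of a Z-tensor\<close>

fun monomial_deriv :: "'n list \<Rightarrow> real ^ 'n \<Rightarrow> real ^ 'n \<Rightarrow> real" where
  "monomial_deriv [] x h = 0"
| "monomial_deriv (j # js) x h = h $ j * (\<Prod>j\<leftarrow>js. x $ j) + x $ j * monomial_deriv js x h"

definition tensor_deriv :: "nat \<Rightarrow> 'n::finite tensor \<Rightarrow> real ^ 'n \<Rightarrow> real ^ 'n \<Rightarrow> real ^ 'n" where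
  "tensor_deriv m A x h = (\<chi> i. \<Sum>js | length js = m - 1. A (i # js) * monomial_deriv js x h)"

lemma has_derivative_monomial:
  "((\<lambda>x :: real ^ 'n::finite. \<Prod>j\<leftarrow>js. x $ j) has_derivative monomial_deriv js x) (at x)"
proof (induction js)
  case (Cons j js)
  have "((\<lambda>x. x $ j) has_derivative (\<lambda>h. h $ j)) (at x)"
    by (intro bounded_linear_imp_has_derivative bounded_linear_vec_nth)
  from has_derivative_mult[OF this Cons] show ?case
    by (simp add: fun_eq_iff add.commute)
qed simp

lemma has_derivative_vec_lambda:
  assumes "\<And>i. ((\<lambda>x. f x i) has_derivative (\<lambda>h. f' h i)) (at x within S)"
  shows "((\<lambda>x. (\<chi> i. f x i) :: real ^ 'n::finite) has_derivative (\<lambda>h. \<chi> i. f' h i)) (at x within S)"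
  using assms
  by (subst has_derivative_componentwise_within) (auto simp: Basis_vec_def inner_axis)

lemma has_derivative_tensor_app:
  fixes x :: "real ^ 'n::finite"
  shows "(tensor_app m A has_derivative tensor_deriv m A x) (at x)"
  unfolding tensor_app_def tensor_deriv_def of_real_eq_id id_def
  by (intro has_derivative_vec_lambda has_derivative_sum has_derivative_mult_right
      has_derivative_monomial)

lemma linear_tensor_deriv: "linear (tensor_deriv m A x)"
  using has_derivative_linear[OF has_derivative_tensor_app] .

lemma continuous_on_tensor_deriv [continuous_intros]:
  assumes "continuous_on S f"
  shows "continuous_on S (\<lambda>p. tensor_deriv m A (f p) h)"
proof -
  have "continuous_on S (\<lambda>p. \<Prod>j\<leftarrow>js. f p $ j)" for js
    by (induction js) (auto intro!: continuous_intros assms)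
  then have "continuous_on S (\<lambda>p. monomial_deriv js (f p) h)" for js
    by (induction js) (auto intro!: continuous_intros assms)
  then show ?thesis
    unfolding tensor_deriv_def by (intro continuous_intros)
qed

text \<open>Linearised form of the comparison behind \<open>Z_solution_le\<close>: at an index where
  \<^term>\<open>\<bar>h $ i\<bar> / x $ i\<close> is largest, the derivative of the diagonal term would strictly exceed that of
  the off-diagonal part if \<open>h\<close> were nonzero, because \<^term>\<open>tensor_app m A x\<close> is positive there.\<close>

lemma Z_tensor_deriv_injective:
  fixes x :: "real ^ 'n::finite"
  assumes Z: "Z_splitting m s B A" and m: "m \<ge> 2"
    and x: "positive_vec x" and Ax: "positive_vec (tensor_app m A x)"
    and h: "tensor_deriv m A x h = 0"
  shows "h = 0"
proof -
  have xp: "x $ j > 0" for j using x by (simp add: positive_vec_def)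
  define \<theta> where "\<theta> = Max (range (\<lambda>j. \<bar>h $ j\<bar> / x $ j))"
  have "\<theta> \<in> range (\<lambda>j. \<bar>h $ j\<bar> / x $ j)"
    unfolding \<theta>_def by (intro Max_in) auto
  then obtain k where k: "\<theta> = \<bar>h $ k\<bar> / x $ k" by auto
  have max: "\<bar>h $ j\<bar> \<le> \<theta> * x $ j" for j
  proof -
    have "\<bar>h $ j\<bar> / x $ j \<le> \<theta>" unfolding \<theta>_def by (intro Max_ge) auto
    then show ?thesis using xp[of j] by (simp add: divide_le_eq)
  qed
  have th0: "\<theta> \<ge> 0" using k xp[of k] by simp
  have pos: "0 \<le> (\<Prod>j\<leftarrow>js. x $ j)" for js
    using xp by (intro prod_list_map_nonneg) (simp add: less_imp_le)
  have monomial: "\<bar>monomial_deriv js x h\<bar> \<le> \<theta> * real (length js) * (\<Prod>j\<leftarrow>js. x $ j)" for js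
  proof (induction js)
    case (Cons j js)
    have "\<bar>monomial_deriv (j # js) x h\<bar>
        \<le> \<bar>h $ j\<bar> * (\<Prod>j\<leftarrow>js. x $ j) + x $ j * \<bar>monomial_deriv js x h\<bar>"
      using abs_triangle_ineq[of "h $ j * (\<Prod>j\<leftarrow>js. x $ j)" "x $ j * monomial_deriv js x h"] xp[of j] pos[of js]
      by (simp add: abs_mult)
    also have "\<dots> \<le> (\<theta> * x $ j) * (\<Prod>j\<leftarrow>js. x $ j)
        + x $ j * (\<theta> * real (length js) * (\<Prod>j\<leftarrow>js. x $ j))"
      using xp[of j] by (intro add_mono mult_right_mono mult_left_mono max pos Cons) auto
    also have "\<dots> = \<theta> * real (length (j # js)) * (\<Prod>j\<leftarrow>j # js. x $ j)"
      by (simp add: algebra_simps)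
    finally show ?case .
  qed simp
  have B_nonneg: "0 \<le> B (k # js)" if "length js = m - 1" for js
    using Z m that by (simp add: Z_splitting_def nonneg_tensor_def)
  have "\<bar>tensor_deriv m B x h $ k\<bar> \<le> (\<Sum>js | length js = m - 1. \<bar>B (k # js) * monomial_deriv js x h\<bar>)"
    by (simp add: tensor_deriv_def)
  also have "\<dots> \<le> (\<Sum>js | length js = m - 1. \<theta> * real (m - 1) * (B (k # js) * (\<Prod>j\<leftarrow>js. x $ j)))"
  proof (rule sum_mono)
    fix js :: "'n list" assume js: "js \<in> {js. length js = m - 1}"
    then have "B (k # js) * \<bar>monomial_deriv js x h\<bar>
        \<le> B (k # js) * (\<theta> * real (length js) * (\<Prod>j\<leftarrow>js. x $ j))"
      by (intro mult_left_mono monomial B_nonneg) auto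
    then show "\<bar>B (k # js) * monomial_deriv js x h\<bar>
        \<le> \<theta> * real (m - 1) * (B (k # js) * (\<Prod>j\<leftarrow>js. x $ j))"
      using js B_nonneg[of js] by (simp add: abs_mult algebra_simps)
  qed
  also have "\<dots> = \<theta> * real (m - 1) * tensor_app m B x $ k"
    by (simp add: tensor_app_nth sum_distrib_left)
  finally have off: "\<bar>tensor_deriv m B x h $ k\<bar> \<le> \<theta> * real (m - 1) * tensor_app m B x $ k" .
  have diag: "tensor_deriv m A x h $ k
      = s * (real (m - 1) * (x $ k) ^ (m - 2) * h $ k) - tensor_deriv m B x h $ k"
  proof -
    have d1: "((\<lambda>z. tensor_app m A z $ k) has_derivative (\<lambda>h. tensor_deriv m A x h $ k)) (at x)"
      using bounded_linear.has_derivative[OF bounded_linear_vec_nth has_derivative_tensor_app] .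
    have nth: "((\<lambda>z :: real ^ 'n. z $ k) has_derivative (\<lambda>h. h $ k)) (at x)"
      by (intro bounded_linear_imp_has_derivative bounded_linear_vec_nth)
    have "((\<lambda>z. s * (z $ k) ^ (m - 1) - tensor_app m B z $ k) has_derivative
        (\<lambda>h. s * (real (m - 1) * (h $ k * (x $ k) ^ (m - 2))) - tensor_deriv m B x h $ k)) (at x)"
      using has_derivative_diff[OF has_derivative_mult_right[OF has_derivative_power[OF nth, where n = "m - 1"]]
          bounded_linear.has_derivative[OF bounded_linear_vec_nth has_derivative_tensor_app], of s m B k]
      by (simp add: numeral_2_eq_2 mult.assoc)
    then have d2: "((\<lambda>z. tensor_app m A z $ k) has_derivative
        (\<lambda>h. s * (real (m - 1) * (h $ k * (x $ k) ^ (m - 2))) - tensor_deriv m B x h $ k)) (at x)"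
      using Z_splitting_app[OF Z] m by simp
    show ?thesis
      using fun_cong[OF has_derivative_unique[OF d1 d2], of h] by (simp add: mult_ac)
  qed
  \<comment> \<open>At \<open>k\<close> the bound on $|h_k|$ is the equality $|h_k| = \<theta> x_k$, which turns
    $x_k^{m-2} |h_k|$ into $\<theta> x_k^{m-1}$.\<close>
  have "s * real (m - 1) * (x $ k) ^ (m - 1) * \<theta> \<le> \<theta> * real (m - 1) * tensor_app m B x $ k"
  proof -
    have "(x $ k) ^ (m - 1) = x $ k * (x $ k) ^ (m - 2)"
      using m by (simp flip: power_Suc add: Suc_diff_Suc numeral_2_eq_2)
    then have "s * real (m - 1) * (x $ k) ^ (m - 1) * \<theta> = s * (real (m - 1) * (x $ k) ^ (m - 2) * \<bar>h $ k\<bar>)"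
      using k xp[of k] by simp
    also have "\<dots> \<le> \<bar>s * (real (m - 1) * (x $ k) ^ (m - 2) * h $ k)\<bar>"
      using xp[of k] by (simp add: abs_mult mult_right_mono)
    also have "\<dots> = \<bar>tensor_deriv m B x h $ k\<bar>"
      using diag h by simp
    finally show ?thesis using off by linarith
  qed
  moreover have Axk: "tensor_app m A x $ k = s * (x $ k) ^ (m - 1) - tensor_app m B x $ k"
    using Z_splitting_app[OF Z] m by simp
  ultimately have "real (m - 1) * \<theta> * tensor_app m A x $ k \<le> 0"
    by (simp only: Axk right_diff_distrib diff_le_0_iff_le mult_ac)
  moreover have "0 < real (m - 1) * tensor_app m A x $ k"
    using m Ax by (simp add: positive_vec_def)
  ultimately have "\<theta> \<le> 0"
    by (smt (verit) mult.commute mult.left_commute mult_pos_pos)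
  then have "\<bar>h $ j\<bar> \<le> 0" for j
    using max[of j] th0 by simp
  then show ?thesis by (simp add: vec_eq_iff)
qed

section \<open>The homotopy\<close>

definition homotopy_tensor :: "'n tensor \<Rightarrow> real \<Rightarrow> 'n tensor" where
  "homotopy_tensor A t = (\<lambda>is. (1 - t) * identity_tensor is + t * A is)"

text \<open>At each time the homotopy equation is the system of a single tensor, which is again a Z-tensor and
  maps the same vector \<open>v\<close> to a positive vector; so the results on one system apply at every time.\<close>

lemma homotopy_map_eq: "homotopy_map m A b x t = tensor_app m (homotopy_tensor A t) x - b"
proof -
  have "tensor_app m (homotopy_tensor A t) x
      = (1 - t) *\<^sub>R tensor_app m identity_tensor x + t *\<^sub>R tensor_app m A x"
    by (simp add: vec_eq_iff tensor_app_nth homotopy_tensor_def sum_distrib_left sum.distrib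
        distrib_right mult.assoc)
  then show ?thesis
    by (simp add: homotopy_map_def algebra_simps)
qed

lemma tensor_deriv_homotopy:
  "tensor_deriv m (homotopy_tensor A t) x h
    = (1 - t) *\<^sub>R tensor_deriv m identity_tensor x h + t *\<^sub>R tensor_deriv m A x h"
  by (simp add: vec_eq_iff tensor_deriv_def homotopy_tensor_def sum_distrib_left sum.distrib
      distrib_right mult.assoc)

lemma positive_solution_homotopy_tensor:
  "positive_solution m (homotopy_tensor A t) b x \<longleftrightarrow> positive_vec x \<and> homotopy_map m A b x t = 0"
  by (simp add: positive_solution_def homotopy_map_eq)

lemma Z_splitting_homotopy:
  assumes "Z_splitting m s B A" "0 \<le> t"
  shows "Z_splitting m (1 - t + t * s) (\<lambda>is. t * B is) (homotopy_tensor A t)"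
proof -
  have "homotopy_tensor A t is = (1 - t + t * s) * identity_tensor is - t * B is" if "length is = m" for "is"
  proof -
    have A: "A is = s * identity_tensor is - B is" using assms(1) that by (simp add: Z_splitting_def)
    show ?thesis unfolding homotopy_tensor_def A by (simp add: algebra_simps)
  qed
  then show ?thesis
    using assms by (auto simp: Z_splitting_def nonneg_tensor_def)
qed

lemma semipositive_homotopy:
  fixes v :: "real ^ 'n::finite"
  assumes v: "positive_vec v" "positive_vec (tensor_app m A v)" and t: "t \<in> {0..1}"
  shows "positive_vec (tensor_app m (homotopy_tensor A t) v)"
proof -
  have "tensor_app m (homotopy_tensor A t) v $ i
      = (1 - t) * (v $ i) ^ (m - 1) + t * tensor_app m A v $ i" for i
    using homotopy_map_eq[of m A 0 v t]
    by (simp add: homotopy_map_def tensor_app_identity vec_power_def vec_eq_iff)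
  moreover have "0 < (1 - t) * (v $ i) ^ (m - 1) + t * tensor_app m A v $ i" for i
  proof (cases "t = 0")
    case False
    then show ?thesis
      using v t by (intro add_nonneg_pos) (auto simp: positive_vec_def less_imp_le)
  qed (use v in \<open>simp add: positive_vec_def\<close>)
  ultimately show ?thesis by (simp add: positive_vec_def)
qed

lemma initial_point_solution:
  fixes b :: "real ^ 'n::finite"
  assumes "m \<ge> 2" "positive_vec b"
  shows "positive_vec (initial_point m b)" "homotopy_map m A b (initial_point m b) 0 = 0"
proof -
  have b: "b $ i > 0" for i using assms by (simp add: positive_vec_def)
  then have "b $ i \<noteq> 0" for i by (metis less_irrefl)
  then show "positive_vec (initial_point m b)"
    by (simp add: positive_vec_def initial_point_def)
  have root: "(b $ i powr (1 / real (m - 1))) ^ (m - 1) = b $ i" for i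
    using b[of i] assms(1) by (simp add: powr_powr flip: powr_realpow)
  have "vec_power (initial_point m b) (m - 1) = b"
    unfolding vec_power_def initial_point_def vec_lambda_beta root by simp
  then show "homotopy_map m A b (initial_point m b) 0 = 0"
    by (simp add: homotopy_map_def tensor_app_identity)
qed

lemma rational_closure_tensor_app:
  fixes x :: "real \<Rightarrow> real ^ 'n::finite"
  assumes "\<And>i. (\<lambda>t. x t $ i) \<in> rational_closure S X"
  shows "(\<lambda>t. tensor_app m A (x t) $ i) \<in> rational_closure S X"
proof -
  have "(\<lambda>t. \<Prod>j\<leftarrow>js. x t $ j) \<in> rational_closure S X" for js
    by (induction js) (auto intro: rational_closure.const rational_closure.mult assms)
  then show ?thesis
    unfolding tensor_app_nth
    by (intro rational_closure_sum rational_closure.mult rational_closure.const)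
qed

lemma rational_closure_tensor_deriv:
  fixes x :: "real \<Rightarrow> real ^ 'n::finite"
  assumes x: "\<And>i. (\<lambda>t. x t $ i) \<in> rational_closure S X"
  shows "(\<lambda>t. tensor_deriv m A (x t) h $ i) \<in> rational_closure S X"
proof -
  have "(\<lambda>t. \<Prod>j\<leftarrow>js. x t $ j) \<in> rational_closure S X" for js
    by (induction js) (auto intro: rational_closure.const rational_closure.mult x)
  then have "(\<lambda>t. monomial_deriv js (x t) h) \<in> rational_closure S X" for js
    by (induction js)
      (auto intro!: rational_closure.const rational_closure.mult rational_closure.add x)
  then show ?thesis
    unfolding tensor_deriv_def vec_lambda_beta
    by (intro rational_closure_sum rational_closure.mult rational_closure.const)
qed

text \<open>Differentiating the homotopy equation along the curve gives a linear system for the velocity,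
  whose matrix is the invertible derivative of the homotopy tensor. So the velocity is a rational
  function of the curve and the time.\<close>

lemma homotopy_curve_smooth:
  fixes A :: "'n::finite tensor" and x :: "real \<Rightarrow> real ^ 'n"
  assumes Z: "Z_splitting m s B A" and m: "m \<ge> 2" and b: "positive_vec b"
    and x: "\<And>t. t \<in> {0..1} \<Longrightarrow> positive_vec (x t) \<and> homotopy_map m A b (x t) t = 0"
  shows "smooth_curve_on {0..1} x"
proof -
  let ?S = "{0..1 :: real}" and ?I = "identity_tensor :: 'n tensor"
  define H where "H p = homotopy_map m A b (fst p) (snd p)" for p
  define velocity where "velocity y = tensor_app m A y - tensor_app m ?I y" for y :: "real ^ 'n"
  define H' where "H' p h = tensor_deriv m (homotopy_tensor A (snd p)) (fst p) (fst h)
      + snd h *\<^sub>R velocity (fst p)" for p h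
  have H': "(H has_derivative H' p) (at p)" for p
  proof -
    have *: "((\<lambda>p :: (real ^ 'n) \<times> real. tensor_app m C (fst p)) has_derivative
        (\<lambda>h. tensor_deriv m C (fst p) (fst h))) (at p)" for C
      by (rule has_derivative_compose[OF has_derivative_fst[OF has_derivative_ident] has_derivative_tensor_app])
    show ?thesis
      unfolding H_def homotopy_map_def H'_def velocity_def tensor_deriv_homotopy
      by (rule has_derivative_eq_rhs, (rule derivative_intros *)+) (simp add: fun_eq_iff algebra_simps)
  qed
  have inj: "h = 0" if t: "t \<in> ?S" and h: "tensor_deriv m (homotopy_tensor A t) (x t) h = 0" for t h
  proof (rule Z_tensor_deriv_injective[where x = "x t"])
    show "Z_splitting m (1 - t + t * s) (\<lambda>is. t * B is) (homotopy_tensor A t)"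
      using Z_splitting_homotopy[OF Z] t by simp
    show "positive_vec (tensor_app m (homotopy_tensor A t) (x t))"
      using x[OF t] b by (simp add: homotopy_map_eq)
  qed (use m x[OF t] h in auto)
  have diff: "\<exists>x'. (x has_vector_derivative x') (at t within ?S)" if t: "t \<in> ?S" for t
  proof (rule implicit_curve_differentiable[OF H', where W = "{y. positive_vec y}"])
    show "continuous_on UNIV (\<lambda>p. H' p h)" for h
      unfolding H'_def velocity_def tensor_deriv_homotopy by (intro continuous_intros)
    show "h = 0" if "H' (x t, t) (h, 0) = 0" for h
      using inj[OF t] that by (simp add: H'_def)
    show "open {y :: real ^ 'n. positive_vec y}"
      unfolding positive_vec_def Collect_all_eq
      by (intro open_INT ballI open_Collect_less continuous_intros) simp
    show "x u \<in> {y. positive_vec y} \<and> H (x u, u) = 0" if "u \<in> ?S" for u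
      using x[OF that] by (simp add: H_def)
    show "y = x u" if "u \<in> ?S" "y \<in> {y. positive_vec y}" "H (y, u) = 0" for u y
      using Z_solution_unique[OF Z_splitting_homotopy[OF Z] m _ _ b, of u y "x u"] x that
      by (simp add: positive_solution_homotopy_tensor H_def)
  qed (rule t)
  then obtain x' where x': "(x has_vector_derivative x' t) (at t within ?S)" if "t \<in> ?S" for t
    by metis
  have eq: "tensor_deriv m (homotopy_tensor A t) (x t) (x' t) = - velocity (x t)" if t: "t \<in> ?S" for t
  proof -
    have "((\<lambda>u. (x u, u)) has_derivative (\<lambda>h. (h *\<^sub>R x' t, h))) (at t within ?S)"
      using x'[OF t] by (intro has_derivative_Pair) (auto simp: has_vector_derivative_def)
    from has_derivative_compose[OF this H']
    have "((\<lambda>u. H (x u, u)) has_derivative (\<lambda>h. H' (x t, t) (h *\<^sub>R x' t, h))) (at t within ?S)"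
      by simp
    then have "((\<lambda>u. 0) has_derivative (\<lambda>h. H' (x t, t) (h *\<^sub>R x' t, h))) (at t within ?S)"
      by (rule has_derivative_transform[rotated 2]) (use t x in \<open>auto simp: H_def\<close>)
    moreover have "H' (x t, t) (h *\<^sub>R x' t, h) = h *\<^sub>R H' (x t, t) (x' t, 1)" for h
      by (simp add: H'_def linear_scale[OF linear_tensor_deriv] scaleR_add_right)
    ultimately have "((\<lambda>u. 0) has_vector_derivative H' (x t, t) (x' t, 1)) (at t within ?S)"
      by (simp add: has_vector_derivative_def)
    then have "H' (x t, t) (x' t, 1) = 0"
      using vector_derivative_unique_within_closed_interval[of 0 1 t "\<lambda>u. 0" _ 0] t
      by (auto simp: cbox_interval)
    then show ?thesis by (simp add: H'_def eq_neg_iff_add_eq_0)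
  qed
  define X where "X = insert (\<lambda>t. t) (range (\<lambda>i t. x t $ i))"
  have gen: "(\<lambda>t. t) \<in> rational_closure ?S X" "(\<lambda>t. x t $ i) \<in> rational_closure ?S X" for i
    by (auto simp: X_def intro: rational_closure.generator)
  define J where "J t = matrix (tensor_deriv m (homotopy_tensor A t) (x t))" for t
  have J: "J t *v h = tensor_deriv m (homotopy_tensor A t) (x t) h" for t h
    unfolding J_def by (intro matrix_works) (simp add: linear_matrix_vector_mul_eq linear_tensor_deriv)
  have "\<exists>y. (\<forall>i. (\<lambda>t. y t $ i) \<in> rational_closure ?S X) \<and>
      (\<forall>t\<in>?S. \<forall>h. J t *v h = - velocity (x t) \<longrightarrow> h = y t)"
  proof (rule rational_closure_linear_system)
    show "(\<lambda>t. J t $ i $ j) \<in> rational_closure ?S X" for i j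
      unfolding J_def matrix_def tensor_deriv_homotopy
      by (simp, intro rational_closure.add rational_closure.mult rational_closure_diff
          rational_closure.const rational_closure_tensor_deriv gen)
    show "(\<lambda>t. (- velocity (x t)) $ i) \<in> rational_closure ?S X" for i
      unfolding velocity_def vector_uminus_component vector_minus_component
      by (intro rational_closure_uminus rational_closure_diff rational_closure_tensor_app gen)
    show "h = 0" if "t \<in> ?S" "J t *v h = 0" for t h
      using inj that by (simp add: J)
  qed
  then obtain y where y: "\<And>i. (\<lambda>t. y t $ i) \<in> rational_closure ?S X"
    and x'y: "\<And>t. t \<in> ?S \<Longrightarrow> x' t = y t"
    using eq unfolding J by blast
  show ?thesis
  proof (rule smooth_curve_on_rational_closure[of X])
    fix f assume "f \<in> X"
    then consider "f = (\<lambda>t. t)" | i where "f = (\<lambda>t. x t $ i)" by (auto simp: X_def)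
    then show "\<exists>f'\<in>rational_closure ?S X. \<forall>t\<in>?S. (f has_real_derivative f' t) (at t within ?S)"
    proof cases
      case 1
      then show ?thesis
        by (intro bexI[of _ "\<lambda>t. 1"]) (auto intro!: derivative_eq_intros rational_closure.const)
    next
      case 2
      then show ?thesis
        using x' x'y y by (intro bexI[of _ "\<lambda>t. y t $ i"]) (auto simp: has_vector_derivative_vec_nth_iff)
    qed
  qed (rule gen)
qed

theorem theorem2p2:
  fixes A :: "'n::finite tensor" and b :: "real ^ 'n" and m :: nat
  assumes "m \<ge> 2"
    and "nonsingular_M_tensor m A"
    and "positive_vec b"
  shows "\<exists>x. solution_curve m A b x \<and>
           (\<forall>y. solution_curve m A b y \<longrightarrow> (\<forall>t\<in>{0..1}. y t = x t)) \<and>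
           positive_solution m A b (x 1) \<and>
           (\<forall>z. positive_solution m A b z \<longrightarrow> z = x 1)"
proof -
  obtain s B and v :: "real ^ 'n" where Z: "Z_splitting m s B A"
    and v: "positive_vec v" "positive_vec (tensor_app m A v)"
    using nonsingular_M_tensor_semipositive[OF assms(2,1)] .
  have unique: "y = z" if "t \<in> {0..1}"
    "positive_vec y \<and> homotopy_map m A b y t = 0" "positive_vec z \<and> homotopy_map m A b z t = 0" for t y z
    using Z_solution_unique[OF Z_splitting_homotopy[OF Z] assms(1) _ _ assms(3), of t y z] that
    by (simp add: positive_solution_homotopy_tensor)
  have "\<exists>y. positive_vec y \<and> homotopy_map m A b y t = 0" if "t \<in> {0..1}" for t
    using Z_solution_exists[OF Z_splitting_homotopy[OF Z] assms(1) v(1) semipositive_homotopy[OF v that] assms(3)]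
      that by (simp add: positive_solution_homotopy_tensor)
  then obtain x where x: "\<And>t. t \<in> {0..1} \<Longrightarrow> positive_vec (x t) \<and> homotopy_map m A b (x t) t = 0"
    by metis
  have "x 0 = initial_point m b"
    using unique[of 0] x[of 0] initial_point_solution[OF assms(1,3)] by auto
  then have "solution_curve m A b x"
    using homotopy_curve_smooth[OF Z assms(1,3) x] x by (simp add: solution_curve_def)
  moreover have "y t = x t" if "solution_curve m A b y" "t \<in> {0..1}" for y t
    using unique[OF that(2)] x[OF that(2)] that by (auto simp: solution_curve_def)
  moreover have at_1: "positive_solution m A b z \<longleftrightarrow> positive_vec z \<and> homotopy_map m A b z 1 = 0" for z
    by (simp add: positive_solution_def homotopy_map_def)
  moreover have "positive_solution m A b (x 1)"
    using x[of 1] by (simp add: at_1)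
  moreover have "z = x 1" if "positive_solution m A b z" for z
    using unique[of 1 z "x 1"] x[of 1] that by (simp add: at_1)
  ultimately show ?thesis by blast
qed

end
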